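(* (a) For every odd $n\ge 3$, equilateral $n$-gons can be characterized by one center function. (b) For every even $n\ge 4$, equilateral $n$-gons cannot be characterized using $n$-gon center functions (no set of $n$-gon center functions $f_1,\ldots,f_k$ characterizes the family of equilateral $n$-gons). This is a consequence of the fact that, for even $n\geq 4$, any $n$-gon center function $f$ must satisfy $$(V_1,\ldots,V_n)\in\mathcal S_n\ \Rightarrow\ f(V_1,\ldots,V_n)=\ldots=f(V_n,V_1,\ldots,V_{n-1}),$$ where $\mathcal S_n$ is the family of equiangular $n$-gons $(V_1,\ldots,V_n)$ such that $\|V_{\rho(i)}-V_{\rho(j)}\|=\|V_{\sigma(i)}-V_{\sigma(j)}\|$ for all $i,j$. Moreover, the family $\mathcal S_n$ can be characterized by one $n$-gon center function.
   Context: An $n$-gon is identified with a tuple $(V_1,\ldots,V_n)$ of points of $\mathbb R^2$ (its labelled vertices), the edges being the segments $V_iV_{i+1}$ (indices mod $n$, taken in $\{1,\ldots,n\}$). The set of all $n$-gons is $\mathcal P_n\approx(\mathbb R^2)^n$. An $n$-gon is equilateral if all its sides have equal length and equiangular if all its angles at the vertices are equal. Let $\rho,\sigma$ be the permutations of $\{1,\ldots,n\}$ given by $\rho(i)=i+1\bmod n$, $\sigma(i)=2+n-i\bmod n$ (so $\sigma(1)=1$). The family $\mathcal S_n$ is thought of as a generalization of rectangles for $n\ge 6$. An $n$-gon center function is a real-valued function $f(V_1,\ldots,V_n)$ such that: (1) $f(V_1,V_2,\ldots,V_n)=f(V_1,V_{\sigma(2)},\ldots,V_{\sigma(n)})$;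 (2) there is $k\in\mathbb N$ (with $0\in\mathbb N$) such that $f(tV_1,\ldots,tV_n)=t^kf(V_1,\ldots,V_n)$ for all $t\in\mathbb R_{\ge 0}$; (3) $f(T(V_1),\ldots,T(V_n))=f(V_1,\ldots,V_n)$ for every rigid motion (isometry) $T$ of the plane. A set of center functions $f_1,\ldots,f_k$ characterizes a family $\mathcal F$ of $n$-gons if: $(V_1,\ldots,V_n)\in\mathcal F$ if and only if $f_l(V_1,\ldots,V_n)=f_l(V_2,\ldots,V_n,V_1)=\ldots=f_l(V_n,V_1,\ldots,V_{n-1})$ for every $l=1,\ldots,k$.
   Formalization: The condition defining S_n is required for every cyclic relabelling of the vertices; for one labelling the claim fails (n=6: equiangular hexagon with sides 3,1,2,2,2,1, f=‖V_6−V_2‖). Angles are unoriented, taken as π/2 at a vertex on a side of length 0. *)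

theory Defs
  imports "HOL-Analysis.Analysis"
begin

type_synonym ngon = "nat \<Rightarrow> real^2"

definition ngons :: "nat \<Rightarrow> ngon set" where
  "ngons n = {1..n} \<rightarrow>\<^sub>E UNIV"

(* The representative of k modulo n in {1..n}. *)
definition idx :: "nat \<Rightarrow> nat \<Rightarrow> nat" where
  "idx n k = (if k mod n = 0 then n else k mod n)"

definition rho_perm :: "nat \<Rightarrow> nat \<Rightarrow> nat" where
  "rho_perm n i = idx n (i + 1)"

definition sigma_perm :: "nat \<Rightarrow> nat \<Rightarrow> nat" where
  "sigma_perm n i = idx n (2 + n - i)"

definition relabel :: "nat \<Rightarrow> (nat \<Rightarrow> nat) \<Rightarrow> ngon \<Rightarrow> ngon" where
  "relabel n p V = (\<lambda>i\<in>{1..n}. V (p i))"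

definition apply_ngon :: "nat \<Rightarrow> (real^2 \<Rightarrow> real^2) \<Rightarrow> ngon \<Rightarrow> ngon" where
  "apply_ngon n T V = (\<lambda>i\<in>{1..n}. T (V i))"

definition rigid_motion :: "(real^2 \<Rightarrow> real^2) \<Rightarrow> bool" where
  "rigid_motion T \<longleftrightarrow> (\<forall>x y. dist (T x) (T y) = dist x y)"

(* Only the values of f on ngons n matter.  Note that 0 ^ 0 = 1, so that
   homogeneity of degree 0 includes the case t = 0. *)
definition center_function :: "nat \<Rightarrow> (ngon \<Rightarrow> real) \<Rightarrow> bool" where
  "center_function n f \<longleftrightarrow>
     (\<forall>V\<in>ngons n. f (relabel n (sigma_perm n) V) = f V) \<and>
     (\<exists>k::nat. \<forall>V\<in>ngons n. \<forall>t\<ge>0. f (apply_ngon n (\<lambda>x. t *\<^sub>R x) V) = t ^ k * f V) \<and>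
     (\<forall>V\<in>ngons n. \<forall>T. rigid_motion T \<longrightarrow> f (apply_ngon n T V) = f V)"

(* relabel n (rho_perm n ^^ k) V is (V (k+1), ..., V n, V 1, ..., V k). *)
definition cyclically_constant :: "nat \<Rightarrow> (ngon \<Rightarrow> real) \<Rightarrow> ngon \<Rightarrow> bool" where
  "cyclically_constant n f V \<longleftrightarrow> (\<forall>k<n. f (relabel n (rho_perm n ^^ k) V) = f V)"

definition characterizes :: "nat \<Rightarrow> (ngon \<Rightarrow> real) set \<Rightarrow> ngon set \<Rightarrow> bool" where
  "characterizes n F \<F> \<longleftrightarrow>
     (\<forall>V\<in>ngons n. V \<in> \<F> \<longleftrightarrow> (\<forall>f\<in>F. cyclically_constant n f V))"

definition equilateral_ngons :: "nat \<Rightarrow> ngon set" where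
  "equilateral_ngons n = {V \<in> ngons n. \<forall>i\<in>{1..n}. \<forall>j\<in>{1..n}.
     dist (V i) (V (rho_perm n i)) = dist (V j) (V (rho_perm n j))}"

(* The unoriented angle ABC in [0, pi].  When A = B or C = B the value is
   arccos 0 = pi / 2, since division by zero yields 0. *)
definition angle_at :: "real^2 \<Rightarrow> real^2 \<Rightarrow> real^2 \<Rightarrow> real" where
  "angle_at A B C = arccos (((A - B) \<bullet> (C - B)) / (norm (A - B) * norm (C - B)))"

(* The angle with index i is the one at the vertex V (rho_perm n i). *)
definition equiangular_ngons :: "nat \<Rightarrow> ngon set" where
  "equiangular_ngons n = {V \<in> ngons n. \<forall>i\<in>{1..n}. \<forall>j\<in>{1..n}.
     angle_at (V i) (V (rho_perm n i)) (V (rho_perm n (rho_perm n i))) =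
     angle_at (V j) (V (rho_perm n j)) (V (rho_perm n (rho_perm n j)))}"

definition S_labelled :: "nat \<Rightarrow> ngon set" where
  "S_labelled n = {V \<in> equiangular_ngons n. \<forall>i\<in>{1..n}. \<forall>j\<in>{1..n}.
     norm (V (rho_perm n i) - V (rho_perm n j)) = norm (V (sigma_perm n i) - V (sigma_perm n j))}"

(* The distance condition in S_labelled depends on which vertex carries the
   label 1: it says that i \<mapsto> 3 - i preserves all distances between vertices.  A
   family that center functions characterize is invariant under cyclic
   relabelling, so the condition is required for every choice of the first
   vertex.  This cannot be omitted: the equiangular convex hexagon with sides
   3, 1, 2, 2, 2, 1 (in this order, from the side V 1 V 2) lies in S_labelled 6,
   but the center function norm (V 6 - V 2) is not cyclically constant on it. *)
definition S_ngons :: "nat \<Rightarrow> ngon set" where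
  "S_ngons n = {V \<in> ngons n. \<forall>k<n. relabel n (rho_perm n ^^ k) V \<in> S_labelled n}"

end

(* For odd n, use the length of the side opposite to the first vertex.

   For even n, let S be the family of polygons whose labelled distances are invariant under all
   reflections i |-> c - i of the labels with c odd (equal angles follow).  A polygon that is
   congruent to its image under i |-> 3 - i has, because of the invariance of center functions
   under i |-> 2 - i, the same values of center functions as its cyclic shift.  So center functions
   are constant on the shifts of a polygon in S, and S contains polygons that are not equilateral.

   Conversely, center functions need not be continuous.  The total distance, multiplied by an
   injective real code of the unordered pair of the normalized distance matrices of V and of its
   reflection by sigma, takes equal values on V and its shift only if the shift is congruent to V
   or to the reflection of V; in both cases V has the symmetries that define S. *)

theory Submission
  imports Defs
begin

section \<open>Congruent families of points in the plane\<close>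

definition perp :: "real^2 \<Rightarrow> real^2" where
  "perp v = vector [- v$2, v$1]"

lemma inner_perp: "a \<bullet> perp u = a$2 * u$1 - a$1 * u$2"
  by (simp add: inner_vec_def sum_2 perp_def)

lemma inner_real2: "(a::real^2) \<bullet> b = a$1 * b$1 + a$2 * b$2"
  by (simp add: inner_vec_def sum_2)

text \<open>Parseval's identity for the orthogonal frame \<open>u\<close>, \<open>perp u\<close>,
  whose vectors have equal length. It is stated without division, so \<open>u\<close> may be
  zero.\<close>

lemma inner_mult_perp:
  "(a \<bullet> u) * (b \<bullet> u) + (a \<bullet> perp u) * (b \<bullet> perp u) = (a \<bullet> b) * (u \<bullet> u)"
  by (simp add: inner_real2 perp_def) algebra

lemma expand_perp: "(a \<bullet> u) *\<^sub>R u + (a \<bullet> perp u) *\<^sub>R perp u = (u \<bullet> u) *\<^sub>R a"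
  by (simp add: vec_eq_iff forall_2 inner_perp inner_real2 perp_def algebra_simps)

lemma norm_perp_combination:
  "(norm (a *\<^sub>R u + b *\<^sub>R perp u))\<^sup>2 = (a\<^sup>2 + b\<^sup>2) * (u \<bullet> u)"
  unfolding power2_norm_eq_inner inner_real2 by (simp add: perp_def) algebra

text \<open>Two distinct points of the first family give a frame \<open>u\<close>,
  \<open>perp u\<close>. The distances determine the components along \<open>u\<close> exactly and
  those along \<open>perp u\<close> up to one common sign, so matching the frames, possibly with a
  flip, gives the motion. If all points coincide, a translation does it.\<close>

lemma congruent_families_rigid_motion:
  fixes x y :: "'i \<Rightarrow> real^2"
  assumes d: "\<And>i j. i \<in> A \<Longrightarrow> j \<in> A \<Longrightarrow> dist (x i) (x j) = dist (y i) (y j)"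
  obtains T where "rigid_motion T" "\<And>i. i \<in> A \<Longrightarrow> T (x i) = y i"
proof (cases "\<forall>i\<in>A. \<forall>j\<in>A. x i = x j")
  case True
  show thesis
  proof (cases "A = {}")
    case True
    then show thesis using that[of id] by (simp add: rigid_motion_def)
  next
    case False
    then obtain q where q: "q \<in> A" by blast
    show thesis
    proof (rule that)
      show "rigid_motion (\<lambda>z. z + (y q - x q))" by (simp add: rigid_motion_def)
      show "x i + (y q - x q) = y i" if "i \<in> A" for i
      proof -
        have eq: "x i = x q" using True that q by blast
        then have "dist (y i) (y q) = 0" using d[OF that q] by (metis dist_self)
        with eq show ?thesis by simp
      qed
    qed
  qed
next
  case False
  then obtain p q where pq: "p \<in> A" "q \<in> A" "x p \<noteq> x q" by auto
  define X Y where "X i = x i - x q" and "Y i = y i - y q" for i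
  define u v where "u = X p" and "v = Y p"
  \<comment> \<open>Polarization: with \<open>q\<close> as origin, the distances determine all inner
    products.\<close>
  have XY: "X i \<bullet> X j = Y i \<bullet> Y j" if "i \<in> A" "j \<in> A" for i j
  proof -
    have "norm (X i) = norm (Y i)" "norm (X j) = norm (Y j)" "norm (X i - X j) = norm (Y i - Y j)"
      using d[OF that] d[OF that(1) pq(2)] d[OF that(2) pq(2)] by (auto simp: X_def Y_def dist_norm)
    then show ?thesis by (simp add: dot_norm_neg)
  qed
  have uv: "u \<bullet> u = v \<bullet> v" "u \<bullet> u \<noteq> 0" using XY[of p p] pq by (auto simp: u_def v_def X_def)
  have Xu: "X i \<bullet> u = Y i \<bullet> v" if "i \<in> A" for i using XY[of i p] that pq by (simp add: u_def v_def)
  have prod: "(X i \<bullet> perp u) * (X j \<bullet> perp u) = (Y i \<bullet> perp v) * (Y j \<bullet> perp v)"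
    if "i \<in> A" "j \<in> A" for i j
    using inner_mult_perp[of "X i" u "X j"] inner_mult_perp[of "Y i" v "Y j"]
    unfolding XY[OF that] uv(1) Xu[OF that(1)] Xu[OF that(2)] by linarith
  \<comment> \<open>By \<open>prod\<close> the squares of the perpendicular components agree, and
    the mixed products force the same sign for all points. The sign is read off at a point off the
    line through \<open>x p\<close> and \<open>x q\<close>; without such a point, 1 serves.\<close>
  have "\<exists>e. e * e = 1 \<and> (\<forall>i\<in>A. e * (X i \<bullet> perp u) = Y i \<bullet> perp v)"
  proof (cases "\<forall>i\<in>A. X i \<bullet> perp u = 0")
    case True
    then have "\<forall>i\<in>A. Y i \<bullet> perp v = 0" using prod by (metis mult_eq_0_iff)
    with True show ?thesis by (intro exI[of _ 1]) simp
  next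
    case False
    then obtain r where r: "r \<in> A" "X r \<bullet> perp u \<noteq> 0" by blast
    define e where "e = (Y r \<bullet> perp v) / (X r \<bullet> perp u)"
    have ee: "e * e = 1" using prod[OF r(1) r(1), symmetric] r by (simp add: e_def)
    have "e * (X i \<bullet> perp u) = Y i \<bullet> perp v" if "i \<in> A" for i
    proof -
      have "X i \<bullet> perp u = e * (Y i \<bullet> perp v)"
        using prod[OF that r(1)] r(2) by (simp add: e_def field_simps)
      then have "e * (X i \<bullet> perp u) = (e * e) * (Y i \<bullet> perp v)" by simp
      then show ?thesis using ee by simp
    qed
    with ee show ?thesis by blast
  qed
  then obtain e where e: "e * e = 1" "\<And>i. i \<in> A \<Longrightarrow> e * (X i \<bullet> perp u) = Y i \<bullet> perp v" by blast
  \<comment> \<open>The linear isometry that takes \<open>u\<close> to \<open>v\<close> and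
    \<open>perp u\<close> to \<open>e *\<^sub>R perp v\<close>.\<close>
  define L where "L z = ((z \<bullet> u) / (u \<bullet> u)) *\<^sub>R v + (e * (z \<bullet> perp u) / (u \<bullet> u)) *\<^sub>R perp v" for z
  have L_diff: "L (a - b) = L a - L b" for a b
    by (simp add: L_def inner_diff_left diff_divide_distrib right_diff_distrib scaleR_left_diff_distrib)
  have L_norm: "norm (L z) = norm z" for z
  proof -
    have "(norm (L z))\<^sup>2 = ((z \<bullet> u) * (z \<bullet> u) + (e * e) * ((z \<bullet> perp u) * (z \<bullet> perp u))) / (u \<bullet> u)"
      unfolding L_def norm_perp_combination uv(1)[symmetric]
      using uv(2) by (simp add: power2_eq_square field_simps)
    also have "\<dots> = (norm z)\<^sup>2"
      using inner_mult_perp[of z u z] e(1) uv(2) by (simp add: power2_norm_eq_inner)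
    finally show ?thesis by simp
  qed
  have L_X: "L (X i) = Y i" if "i \<in> A" for i
  proof -
    have "L (X i) = (1 / (u \<bullet> u)) *\<^sub>R ((Y i \<bullet> v) *\<^sub>R v + (Y i \<bullet> perp v) *\<^sub>R perp v)"
      by (simp add: L_def Xu[OF that] e(2)[OF that] scaleR_add_right)
    also have "\<dots> = Y i" unfolding expand_perp using uv by simp
    finally show ?thesis .
  qed
  show thesis
  proof (rule that)
    show "rigid_motion (\<lambda>z. y q + L (z - x q))"
      unfolding rigid_motion_def
    proof (intro allI)
      fix a b
      have "norm (L (a - x q) - L (b - x q)) = norm (a - b)"
        by (simp add: L_diff[symmetric] L_norm)
      then show "dist (y q + L (a - x q)) (y q + L (b - x q)) = dist a b"
        by (simp add: dist_norm)
    qed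
    show "y q + L (x i - x q) = y i" if "i \<in> A" for i
      using L_X[OF that] by (simp add: X_def Y_def)
  qed
qed

section \<open>Injective codes for real-valued functions\<close>

text \<open>Reals can be traded for sets of naturals. A countable family of such sets is a subset of
  a countable product, hence again a set of naturals, which is sent back into the reals.\<close>

lemma ex_inj_real_fun:
  "\<exists>E :: ('a::countable \<Rightarrow> real) \<Rightarrow> real. inj E"
proof -
  have "(UNIV :: real set) \<lesssim> (UNIV :: nat set set)" "(UNIV :: nat set set) \<lesssim> (UNIV :: real set)"
    using nat_sets_eqpoll_reals by (simp_all add: eqpoll_imp_lepoll eqpoll_sym)
  then obtain g :: "real \<Rightarrow> nat set" and h :: "nat set \<Rightarrow> real" where g: "inj g" and h: "inj h"
    by (auto simp: lepoll_def)
  have "inj (\<lambda>F :: 'a \<Rightarrow> real. h (to_nat ` {(a, b). b \<in> g (F a)}))"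
  proof (rule injI)
    fix F G :: "'a \<Rightarrow> real"
    assume "h (to_nat ` {(a, b). b \<in> g (F a)}) = h (to_nat ` {(a, b). b \<in> g (G a)})"
    then have "{(a, b). b \<in> g (F a)} = {(a, b). b \<in> g (G a)}"
      using h by (simp add: inj_eq inj_image_eq_iff)
    then have "g (F a) = g (G a)" for a by auto
    then show "F = G" using g by (auto simp: inj_eq)
  qed
  then show ?thesis by blast
qed

definition code_fun :: "('a::countable \<Rightarrow> real) \<Rightarrow> real" where
  "code_fun = (SOME E. inj E)"

lemma code_fun_eq_iff [simp]: "code_fun F = code_fun G \<longleftrightarrow> F = G"
  using someI_ex[OF ex_inj_real_fun] unfolding code_fun_def by (rule inj_eq)

section \<open>Periodic extension of the vertex labels\<close>

text \<open>Labels are taken in the integers so that a reflection \<open>c - i\<close> involves no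
  truncated subtraction.\<close>

definition res :: "nat \<Rightarrow> int \<Rightarrow> nat" where
  "res n z = idx n (nat (z mod int n))"

lemma res_cong: "z mod int n = w mod int n \<Longrightarrow> res n z = res n w"
  by (simp add: res_def)

lemma res_in: "n > 0 \<Longrightarrow> res n z \<in> {1..n}"
  by (auto simp: res_def idx_def nat_mod_distrib Suc_le_eq less_imp_le)

lemma idx_eq_res: "idx n k = res n (int k)"
  unfolding res_def zmod_int[symmetric] nat_int by (simp add: idx_def)

lemma res_id: "i \<in> {1..n} \<Longrightarrow> res n (int i) = i"
  by (cases "i = n") (auto simp: idx_eq_res[symmetric] idx_def)

lemma int_res_mod:
  assumes "n > 0" shows "int (res n z) mod int n = z mod int n"
proof -
  define k where "k = nat (z mod int n)"
  have k: "int k = z mod int n" "k < n" using assms by (simp_all add: k_def nat_less_iff)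
  then have "res n z = (if k = 0 then n else k)" by (simp add: res_def idx_def flip: k_def)
  then show ?thesis using k by auto
qed

lemma res_add_res: "n > 0 \<Longrightarrow> res n (int (res n z) + a) = res n (z + a)"
  by (intro res_cong mod_add_cong int_res_mod refl)

lemma res_diff_res: "n > 0 \<Longrightarrow> res n (a - int (res n z)) = res n (a - z)"
  by (intro res_cong mod_diff_cong int_res_mod refl)

lemma res_res_diff: "n > 0 \<Longrightarrow> res n (int (res n z) - a) = res n (z - a)"
  using res_add_res[of n z "- a"] by simp

lemma bij_res_add: "n > 0 \<Longrightarrow> bij_betw (\<lambda>i. res n (int i + a)) {1..n} {1..n}"
  by (rule bij_betw_byWitness[where f' = "\<lambda>i. res n (int i - a)"])
     (use res_in in \<open>auto simp: res_add_res res_res_diff res_id\<close>)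

lemma bij_res_diff: "n > 0 \<Longrightarrow> bij_betw (\<lambda>i. res n (a - int i)) {1..n} {1..n}"
  by (rule bij_betw_byWitness[where f' = "\<lambda>i. res n (a - int i)"])
     (use res_in in \<open>auto simp: res_diff_res res_id\<close>)

lemma rho_perm_eq_res: "rho_perm n i = res n (int i + 1)"
  by (simp add: rho_perm_def idx_eq_res add.commute)

lemma sigma_perm_eq_res:
  assumes "i \<le> n" shows "sigma_perm n i = res n (2 - int i)"
proof -
  have "int (2 + n - i) = (2 - int i) + int n" using assms by simp
  then show ?thesis unfolding sigma_perm_def idx_eq_res by (metis mod_add_self2 res_cong)
qed

lemma rho_perm_funpow_eq_res:
  assumes "n > 0" "i \<in> {1..n}" shows "(rho_perm n ^^ k) i = res n (int i + int k)"
proof (induction k)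
  case 0 then show ?case using assms by (simp add: res_id)
next
  case (Suc k)
  then show ?case
    using res_add_res[OF assms(1), of "int i + int k" 1]
    by (simp add: rho_perm_eq_res algebra_simps)
qed

definition ext :: "nat \<Rightarrow> ngon \<Rightarrow> int \<Rightarrow> real^2" where
  "ext n V z = V (res n z)"

lemma ext_cong: "z mod int n = w mod int n \<Longrightarrow> ext n V z = ext n V w"
  unfolding ext_def by (rule arg_cong[OF res_cong])

lemma ext_id: "i \<in> {1..n} \<Longrightarrow> ext n V (int i) = V i"
  by (simp add: ext_def res_id)

lemma ext_rho: "n > 0 \<Longrightarrow> ext n (relabel n (rho_perm n ^^ k) V) z = ext n V (z + int k)"
  using res_in[of n z] by (simp add: ext_def relabel_def rho_perm_funpow_eq_res res_add_res)

lemma ext_rho1: "n > 0 \<Longrightarrow> ext n (relabel n (rho_perm n) V) z = ext n V (z + 1)"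
  using ext_rho[of n 1] by simp

lemma ext_sigma: "n > 0 \<Longrightarrow> ext n (relabel n (sigma_perm n) V) z = ext n V (2 - z)"
  using res_in[of n z] by (simp add: ext_def relabel_def sigma_perm_eq_res res_diff_res)

lemma ext_apply: "n > 0 \<Longrightarrow> ext n (apply_ngon n T V) z = T (ext n V z)"
  using res_in[of n z] by (simp add: ext_def apply_ngon_def)

lemma relabel_in_ngons [simp]: "relabel n p V \<in> ngons n"
  by (auto simp: ngons_def relabel_def)

lemma ngons_eqI:
  assumes "V \<in> ngons n" "W \<in> ngons n" "\<And>z. ext n V z = ext n W z" shows "V = W"
proof (rule PiE_ext)
  show "V i = W i" if "i \<in> {1..n}" for i using assms(3)[of "int i"] that by (simp add: ext_id)
qed (use assms in \<open>auto simp: ngons_def\<close>)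

lemma relabel_sigma_sigma:
  assumes "n > 0" "V \<in> ngons n"
  shows "relabel n (sigma_perm n) (relabel n (sigma_perm n) V) = V"
  by (rule ngons_eqI[of _ n]) (use assms in \<open>auto simp: ext_sigma\<close>)

lemma relabel_rho_Suc:
  "n > 0 \<Longrightarrow> relabel n (rho_perm n) (relabel n (rho_perm n ^^ k) V) = relabel n (rho_perm n ^^ Suc k) V"
  by (rule ngons_eqI[of _ n]) (simp_all add: ext_rho ext_rho1 add_ac del: funpow.simps)

lemma relabel_rho_0: "V \<in> ngons n \<Longrightarrow> n > 0 \<Longrightarrow> relabel n (rho_perm n ^^ 0) V = V"
  by (rule ngons_eqI[of _ n]) (simp_all only: ext_rho relabel_in_ngons of_nat_0 add_0_right)

lemma relabel_rho_n: "V \<in> ngons n \<Longrightarrow> n > 0 \<Longrightarrow> relabel n (rho_perm n ^^ n) V = V"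
  by (rule ngons_eqI[of _ n]) (auto simp: ext_rho intro!: ext_cong)

section \<open>Distances between vertices with integer labels, and the effect of relabellings,
  scalings and motions on them\<close>

definition vdist :: "nat \<Rightarrow> ngon \<Rightarrow> int \<Rightarrow> int \<Rightarrow> real" where
  "vdist n V z w = dist (ext n V z) (ext n V w)"

lemma vdist_cong:
  assumes "z mod int n = z' mod int n" "w mod int n = w' mod int n"
  shows "vdist n V z w = vdist n V z' w'"
  unfolding vdist_def ext_cong[OF assms(1)] ext_cong[OF assms(2)] ..

lemma vdist_res: "n > 0 \<Longrightarrow> vdist n V (int (res n z)) (int (res n w)) = vdist n V z w"
  by (intro vdist_cong int_res_mod)

lemma vdist_commute: "vdist n V z w = vdist n V w z"
  by (simp add: vdist_def dist_commute)

lemma vdist_rho: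
  "n > 0 \<Longrightarrow> vdist n (relabel n (rho_perm n ^^ k) V) z w = vdist n V (z + int k) (w + int k)"
  by (simp add: vdist_def ext_rho)

lemma vdist_rho1: "n > 0 \<Longrightarrow> vdist n (relabel n (rho_perm n) V) z w = vdist n V (z + 1) (w + 1)"
  by (simp add: vdist_def ext_rho1)

lemma vdist_sigma:
  "n > 0 \<Longrightarrow> vdist n (relabel n (sigma_perm n) V) z w = vdist n V (2 - z) (2 - w)"
  by (simp add: vdist_def ext_sigma)

lemma vdist_scale:
  "n > 0 \<Longrightarrow> t \<ge> 0 \<Longrightarrow> vdist n (apply_ngon n (\<lambda>x. t *\<^sub>R x) V) z w = t * vdist n V z w"
  by (simp add: vdist_def ext_apply dist_norm flip: scaleR_diff_right)

lemma vdist_rigid: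
  "n > 0 \<Longrightarrow> rigid_motion T \<Longrightarrow> vdist n (apply_ngon n T V) z w = vdist n V z w"
  by (simp add: vdist_def ext_apply rigid_motion_def)

lemma rho_perm_vertex: "V (rho_perm n i) = ext n V (int i + 1)"
  by (simp add: ext_def rho_perm_eq_res)

lemma rho_perm_rho_perm_vertex: "n > 0 \<Longrightarrow> V (rho_perm n (rho_perm n i)) = ext n V (int i + 2)"
  using res_add_res[of n "int i + 1" 1] by (simp add: ext_def rho_perm_eq_res add.commute)

lemma sigma_perm_vertex: "i \<le> n \<Longrightarrow> V (sigma_perm n i) = ext n V (2 - int i)"
  by (simp add: ext_def sigma_perm_eq_res)

section \<open>Equilateral polygons with an odd number of sides\<close>

lemma equilateral_iff:
  assumes "n > 0" "V \<in> ngons n"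
  shows "V \<in> equilateral_ngons n \<longleftrightarrow> (\<forall>z w. vdist n V z (z + 1) = vdist n V w (w + 1))"
proof
  assume V: "V \<in> equilateral_ngons n"
  show "\<forall>z w. vdist n V z (z + 1) = vdist n V w (w + 1)"
  proof (intro allI)
    fix z w
    have side: "dist (V (res n x)) (V (rho_perm n (res n x))) = vdist n V x (x + 1)" for x
      using assms(1) by (simp add: vdist_def ext_def rho_perm_eq_res res_add_res)
    show "vdist n V z (z + 1) = vdist n V w (w + 1)"
      using V res_in[OF assms(1)] by (simp add: equilateral_ngons_def flip: side)
  qed
next
  assume V: "\<forall>z w. vdist n V z (z + 1) = vdist n V w (w + 1)"
  have "dist (V i) (V (rho_perm n i)) = vdist n V (int i) (int i + 1)" if "i \<in> {1..n}" for i
    using that by (simp add: vdist_def ext_id rho_perm_vertex)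
  with V assms(2) show "V \<in> equilateral_ngons n" unfolding equilateral_ngons_def by auto
qed

text \<open>Modulo \<open>2 * m + 1\<close>, the map \<open>2 - z\<close> interchanges
  \<open>m + 1\<close> and \<open>m + 2\<close>, so it preserves this side. A side from
  \<open>z\<close> to \<open>z + 1\<close> is preserved only if \<open>2 * z\<close> is congruent to
  1, which is impossible for even \<open>n\<close>.\<close>

lemma center_function_opposite_side:
  assumes "n = 2 * m + 1" "m \<ge> 1"
  shows "center_function n (\<lambda>V. vdist n V (int m + 1) (int m + 2))"
  unfolding center_function_def
proof (intro conjI ballI exI[of _ 1] allI impI)
  have n: "n > 0" using assms by simp
  fix V :: ngon
  have "vdist n V (2 - (int m + 1)) (2 - (int m + 2)) = vdist n V (int m + 2) (int m + 1)"
  proof (rule vdist_cong)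
    have "int m + 2 = 2 - (int m + 1) + int n" using assms by simp
    then show "(2 - (int m + 1)) mod int n = (int m + 2) mod int n" by (metis mod_add_self2)
    have "int m + 1 = 2 - (int m + 2) + int n" using assms by simp
    then show "(2 - (int m + 2)) mod int n = (int m + 1) mod int n" by (metis mod_add_self2)
  qed
  then show "vdist n (relabel n (sigma_perm n) V) (int m + 1) (int m + 2) = vdist n V (int m + 1) (int m + 2)"
    using n by (metis vdist_sigma vdist_commute)
  show "vdist n (apply_ngon n (\<lambda>x. t *\<^sub>R x) V) (int m + 1) (int m + 2)
      = t ^ 1 * vdist n V (int m + 1) (int m + 2)" if "t \<ge> 0" for t
    using n that by (simp add: vdist_scale)
  show "vdist n (apply_ngon n T V) (int m + 1) (int m + 2) = vdist n V (int m + 1) (int m + 2)"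
    if "rigid_motion T" for T
    using n that by (simp add: vdist_rigid)
qed

lemma cyclically_constant_side_iff:
  assumes n: "n > 0" and V: "V \<in> ngons n"
  shows "cyclically_constant n (\<lambda>V. vdist n V a (a + 1)) V \<longleftrightarrow> V \<in> equilateral_ngons n"
proof -
  have "(\<forall>k<n. vdist n V (a + int k) (a + 1 + int k) = vdist n V a (a + 1))
      \<longleftrightarrow> (\<forall>z. vdist n V z (z + 1) = vdist n V a (a + 1))" (is "?L \<longleftrightarrow> ?R")
  proof
    assume L: ?L
    show ?R
    proof
      fix z
      \<comment> \<open>The shift below \<open>n\<close> that carries label \<open>a\<close> to
        \<open>z\<close> modulo \<open>n\<close>.\<close>
      define k where "k = nat ((z - a) mod int n)"
      have k: "int k = (z - a) mod int n" "k < n" using n by (simp_all add: k_def nat_less_iff)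
      have "(a + int k) mod int n = z mod int n" "(a + 1 + int k) mod int n = (z + 1) mod int n"
        using mod_add_right_eq[of a "z - a" "int n"] mod_add_right_eq[of "a + 1" "z - a" "int n"]
        by (simp_all add: k(1) add.commute)
      then have "vdist n V (a + int k) (a + 1 + int k) = vdist n V z (z + 1)" by (rule vdist_cong)
      with L k(2) show "vdist n V z (z + 1) = vdist n V a (a + 1)" by metis
    qed
  next
    assume ?R
    then show ?L by (metis add.assoc add.commute)
  qed
  then show ?thesis
    using n V by (simp add: cyclically_constant_def vdist_rho equilateral_iff) metis
qed

section \<open>Center functions on generalized rectangles\<close>

text \<open>The distance condition makes the cyclic shift of \<open>V\<close> congruent to its
  reflection by \<open>sigma_perm\<close>. A motion \<open>T\<close> takes the former to the latter,
  and \<open>f\<close> is invariant under both \<open>T\<close> and the reflection.\<close>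

lemma S_labelled_shift:
  assumes f: "center_function n f" and V: "V \<in> S_labelled n"
  shows "f (relabel n (rho_perm n) V) = f V"
proof -
  have V': "V \<in> ngons n" using V by (simp add: S_labelled_def equiangular_ngons_def)
  obtain T where T: "rigid_motion T" "\<And>i. i \<in> {1..n} \<Longrightarrow> T (V (rho_perm n i)) = V (sigma_perm n i)"
    using congruent_families_rigid_motion[of "{1..n}" "\<lambda>i. V (rho_perm n i)" "\<lambda>i. V (sigma_perm n i)"]
      V by (auto simp: S_labelled_def dist_norm)
  have "apply_ngon n T (relabel n (rho_perm n) V) = relabel n (sigma_perm n) V"
    using T(2) by (auto simp: apply_ngon_def relabel_def fun_eq_iff)
  then show ?thesis
    using f T(1) V' unfolding center_function_def by (metis relabel_in_ngons)
qed

lemma S_ngons_cyclically_constant: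
  assumes n: "n > 0" and f: "center_function n f" and V: "V \<in> S_ngons n"
  shows "cyclically_constant n f V"
  unfolding cyclically_constant_def
proof (intro allI impI)
  have V': "V \<in> ngons n" using V by (simp add: S_ngons_def)
  fix k assume "k < n"
  then show "f (relabel n (rho_perm n ^^ k) V) = f V"
  proof (induction k)
    case 0
    show ?case unfolding relabel_rho_0[OF V' n] ..
  next
    case (Suc k)
    then have "relabel n (rho_perm n ^^ k) V \<in> S_labelled n" "f (relabel n (rho_perm n ^^ k) V) = f V"
      using V by (simp_all add: S_ngons_def)
    then show ?case using S_labelled_shift[OF f] by (metis relabel_rho_Suc[OF n])
  qed
qed

text \<open>By the law of cosines, \<open>angle_at\<close> is a function of the three distances,
  including its default value in degenerate cases.\<close>

lemma angle_at_cong: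
  assumes "dist A B = dist A' B'" "dist C B = dist C' B'" "dist A C = dist A' C'"
  shows "angle_at A B C = angle_at A' B' C'"
proof -
  have ip: "(A - B) \<bullet> (C - B) = ((dist A B)\<^sup>2 + (dist C B)\<^sup>2 - (dist A C)\<^sup>2) / 2" for A B C :: "real^2"
    by (simp add: dot_norm_neg dist_norm)
  show ?thesis unfolding angle_at_def ip dist_norm[symmetric] assms ..
qed

lemma angle_at_commute: "angle_at A B C = angle_at C B A"
  by (simp add: angle_at_def inner_commute mult.commute)

text \<open>The reflection with constant \<open>z + w + 2\<close> reverses the triple of consecutive
  labels from \<open>z\<close> into the one from \<open>w\<close>. The constant is odd when
  \<open>z\<close> and \<open>w\<close> have different parity; labels of equal parity are compared
  through \<open>z + 1\<close>.\<close>

lemma equiangular_if_reflections: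
  assumes n: "n > 0" and V: "V \<in> ngons n"
    and refl: "\<And>k z w. vdist n V (2 * k + 1 - z) (2 * k + 1 - w) = vdist n V z w"
  shows "V \<in> equiangular_ngons n"
proof -
  define a where "a z = angle_at (ext n V z) (ext n V (z + 1)) (ext n V (z + 2))" for z
  have odd: "a z = a w" if "odd (z + w)" for z w
  proof -
    from that obtain k where k: "z + w = 2 * k + 1" by (rule oddE)
    have "a z = angle_at (ext n V (w + 2)) (ext n V (w + 1)) (ext n V w)"
      unfolding a_def
    proof (rule angle_at_cong)
      have *: "w + 2 = 2 * (k + 1) + 1 - z" "w + 1 = 2 * (k + 1) + 1 - (z + 1)"
        "w = 2 * (k + 1) + 1 - (z + 2)"
        using k by simp_all
      show "dist (ext n V z) (ext n V (z + 1)) = dist (ext n V (w + 2)) (ext n V (w + 1))"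
        "dist (ext n V (z + 2)) (ext n V (z + 1)) = dist (ext n V w) (ext n V (w + 1))"
        "dist (ext n V z) (ext n V (z + 2)) = dist (ext n V (w + 2)) (ext n V w)"
        by (metis * refl vdist_def)+
    qed
    then show ?thesis by (simp add: a_def angle_at_commute)
  qed
  have const: "a z = a w" for z w
  proof (cases "odd (z + w)")
    case False
    then have "a z = a (z + 1)" "a (z + 1) = a w" by (intro odd; simp)+
    then show ?thesis by simp
  qed (rule odd)
  have "angle_at (V i) (V (rho_perm n i)) (V (rho_perm n (rho_perm n i))) = a (int i)"
    if "i \<in> {1..n}" for i
    using that n by (simp add: a_def ext_id rho_perm_vertex[of V n i] rho_perm_rho_perm_vertex)
  then show ?thesis using V const unfolding equiangular_ngons_def by auto
qed

text \<open>Shifting the labels by \<open>k\<close> changes the constant of a reflection by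
  \<open>2 * k\<close>. Its parity stays odd, so the hypothesis passes to all cyclic shifts.\<close>

lemma S_ngonsI:
  assumes n: "n > 0" and V: "V \<in> ngons n"
    and refl: "\<And>k z w. vdist n V (2 * k + 1 - z) (2 * k + 1 - w) = vdist n V z w"
  shows "V \<in> S_ngons n"
proof -
  have "relabel n (rho_perm n ^^ k) V \<in> S_labelled n" for k
  proof -
    define W where "W = relabel n (rho_perm n ^^ k) V"
    have refl_W: "vdist n W (2 * j + 1 - z) (2 * j + 1 - w) = vdist n W z w" for j z w
      using refl[of "j + int k" "z + int k" "w + int k"]
      by (simp add: W_def vdist_rho[OF n] algebra_simps)
    have "W \<in> equiangular_ngons n"
      by (rule equiangular_if_reflections[OF n _ refl_W]) (simp add: W_def)
    moreover have "norm (W (rho_perm n i) - W (rho_perm n j)) = norm (W (sigma_perm n i) - W (sigma_perm n j))"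
      if "i \<in> {1..n}" "j \<in> {1..n}" for i j
      \<comment> \<open>The reflection with constant 3 takes \<open>i + 1\<close>, the label given
        by \<open>rho_perm\<close>, to \<open>2 - i\<close>, the label given by
        \<open>sigma_perm\<close>.\<close>
      using refl_W[of 1 "int i + 1" "int j + 1"] that
      by (simp add: vdist_def dist_norm rho_perm_vertex sigma_perm_vertex)
    ultimately show ?thesis by (simp add: S_labelled_def flip: W_def)
  qed
  with V show ?thesis by (simp add: S_ngons_def)
qed

section \<open>A generalized rectangle that is not equilateral\<close>

definition circle_point :: "nat \<Rightarrow> int \<Rightarrow> real^2" where
  "circle_point m k = vector [cos (2 * pi * of_int k / of_nat m), sin (2 * pi * of_int k / of_nat m)]"

lemma circle_point_periodic:
  assumes "m > 0" shows "circle_point m (k + int m * q) = circle_point m k"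
proof -
  have "2 * pi * of_int (k + int m * q) / of_nat m = 2 * pi * of_int k / of_nat m + 2 * pi * of_int q"
    using assms by (simp add: field_simps)
  then show ?thesis
    unfolding circle_point_def by (simp only: cos_add sin_add cos_int_2pin sin_int_2pin) simp
qed

text \<open>The chord length depends only on the difference of the labels, so reflections of labels
  preserve it.\<close>

lemma dist_circle_point:
  "dist (circle_point m a) (circle_point m b) = sqrt (2 - 2 * cos (2 * pi * of_int (a - b) / of_nat m))"
proof -
  define s t where "s = 2 * pi * of_int a / of_nat m" and "t = 2 * pi * of_int b / of_nat m"
  have "2 * pi * of_int (a - b) / of_nat m = s - t"
    by (simp add: s_def t_def diff_divide_distrib right_diff_distrib)
  moreover have "(cos s - cos t)\<^sup>2 + (sin s - sin t)\<^sup>2 = 2 - 2 * cos (s - t)"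
    using sin_cos_squared_add[of s] sin_cos_squared_add[of t]
    by (simp add: cos_diff power2_diff algebra_simps)
  ultimately show ?thesis
    by (simp add: circle_point_def dist_norm norm_vec_def L2_set_def sum_2 flip: s_def t_def)
qed

text \<open>A regular polygon with every vertex taken twice, so the sides alternate between 0 and a positive length.\<close>

definition doubled_polygon :: "nat \<Rightarrow> ngon" where
  "doubled_polygon m = (\<lambda>i\<in>{1..2 * m}. circle_point m ((int i + 1) div 2))"

text \<open>Raising \<open>z\<close> by \<open>2 * m\<close> raises \<open>(z + 1) div 2\<close> by
  \<open>m\<close>, which is a full turn.\<close>

lemma ext_doubled_polygon:
  assumes "m > 0"
  shows "ext (2 * m) (doubled_polygon m) z = circle_point m ((z + 1) div 2)"
proof -
  define r where "r = res (2 * m) z"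
  have r: "r \<in> {1..2 * m}" "int r mod int (2 * m) = z mod int (2 * m)"
    unfolding r_def by (use assms in \<open>intro res_in int_res_mod; simp\<close>)+
  then obtain q where "z = int r + int (2 * m) * q"
    by (metis mod_eqE)
  then have "(z + 1) div 2 = (int r + 1 + 2 * (int m * q)) div 2"
    by (simp add: algebra_simps)
  also have "\<dots> = (int r + 1) div 2 + int m * q" by simp
  finally show ?thesis
    using assms r(1) by (simp add: ext_def doubled_polygon_def circle_point_periodic flip: r_def)
qed

text \<open>A reflection with odd constant permutes the pairs of labels \<open>2 * y - 1\<close>,
  \<open>2 * y\<close> of coinciding vertices, and so acts as a reflection of the underlying regular
  polygon.\<close>

lemma doubled_polygon_in_S_ngons:
  assumes "m > 0" shows "doubled_polygon m \<in> S_ngons (2 * m)"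
proof (rule S_ngonsI)
  show "doubled_polygon m \<in> ngons (2 * m)" by (auto simp: doubled_polygon_def ngons_def)
  fix k z w :: int
  define g where "g x = (x + 1) div 2" for x :: int
  have g: "g (2 * k + 1 - x) = k + 1 - g x" for x
    unfolding g_def by presburger
  have dist: "vdist (2 * m) (doubled_polygon m) x y
      = sqrt (2 - 2 * cos (2 * pi * of_int (g x - g y) / of_nat m))" for x y
    unfolding vdist_def ext_doubled_polygon[OF assms] dist_circle_point g_def ..
  have "2 * pi * of_int (g w - g z) / of_nat m = - (2 * pi * of_int (g z - g w) / of_nat m)"
    by (simp add: algebra_simps diff_divide_distrib)
  then have "cos (2 * pi * of_int (g w - g z) / of_nat m) = cos (2 * pi * of_int (g z - g w) / of_nat m)"
    by (simp only: cos_minus)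
  then show "vdist (2 * m) (doubled_polygon m) (2 * k + 1 - z) (2 * k + 1 - w)
      = vdist (2 * m) (doubled_polygon m) z w"
    unfolding dist g by simp
qed (use assms in simp)

lemma doubled_polygon_not_equilateral:
  assumes "m \<ge> 2" shows "doubled_polygon m \<notin> equilateral_ngons (2 * m)"
proof
  assume E: "doubled_polygon m \<in> equilateral_ngons (2 * m)"
  then have "doubled_polygon m \<in> ngons (2 * m)" by (simp add: equilateral_ngons_def)
  \<comment> \<open>Vertices 1 and 2 coincide, while the side from 2 to 3 joins neighbours on the
    circle.\<close>
  then have "vdist (2 * m) (doubled_polygon m) 2 (2 + 1) = vdist (2 * m) (doubled_polygon m) 1 (1 + 1)"
    using E equilateral_iff[of "2 * m" "doubled_polygon m"] assms
    by (metis mult_pos_pos not_numeral_le_zero zero_less_iff_neq_zero zero_neq_numeral)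
  then have "cos (2 * pi / of_nat m) = 1"
    using assms by (simp add: vdist_def ext_doubled_polygon dist_circle_point)
  moreover have "cos (2 * pi / of_nat m) < cos 0"
    using assms by (intro cos_monotone_0_pi) (auto simp: field_simps)
  ultimately show False by simp
qed

section \<open>A center function characterizing the generalized rectangles\<close>

text \<open>A size of degree 1 that ignores the order of the labels and vanishes only if all
  vertices coincide.\<close>

definition total_dist :: "nat \<Rightarrow> ngon \<Rightarrow> real" where
  "total_dist n V = (\<Sum>i\<in>{1..n}. \<Sum>j\<in>{1..n}. vdist n V (int i) (int j))"

text \<open>Normalizing removes the scale, and the code keeps the entire distance matrix in one
  real. If all vertices coincide, division by zero yields the zero matrix.\<close>

definition shape :: "nat \<Rightarrow> ngon \<Rightarrow> real" where
  "shape n V = code_fun (\<lambda>(z, w). vdist n V z w / total_dist n V)"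

text \<open>Minimum and maximum represent the unordered pair of codes, which makes the value
  invariant under \<open>sigma_perm\<close>; the factor \<open>total_dist\<close> supplies
  homogeneity of degree 1.\<close>

definition size_shape :: "nat \<Rightarrow> ngon \<Rightarrow> real" where
  "size_shape n V = total_dist n V *
     code_fun (\<lambda>b. (if b then min else max) (shape n V) (shape n (relabel n (sigma_perm n) V)))"

lemma total_dist_reindex:
  assumes n: "n > 0" and bij: "bij_betw (\<lambda>i. res n (q (int i))) {1..n} {1..n}"
  shows "(\<Sum>i\<in>{1..n}. \<Sum>j\<in>{1..n}. vdist n V (q (int i)) (q (int j))) = total_dist n V"
proof -
  have reindex: "(\<Sum>i\<in>{1..n}. g (int (res n (q (int i))))) = (\<Sum>i\<in>{1..n}. g (int i))" for g :: "int \<Rightarrow> real"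
    by (rule sum.reindex_bij_betw[OF bij])
  have "(\<Sum>i\<in>{1..n}. \<Sum>j\<in>{1..n}. vdist n V (int (res n (q (int i)))) (int (res n (q (int j)))))
      = (\<Sum>i\<in>{1..n}. \<Sum>j\<in>{1..n}. vdist n V (int (res n (q (int i)))) (int j))"
    by (intro sum.cong refl reindex)
  also have "\<dots> = total_dist n V"
    unfolding total_dist_def by (rule reindex)
  finally show ?thesis unfolding vdist_res[OF n] .
qed

lemma total_dist_rho:
  assumes "n > 0" shows "total_dist n (relabel n (rho_perm n) V) = total_dist n V"
  using total_dist_reindex[where q = "\<lambda>z. z + 1" and V = V, OF assms bij_res_add[OF assms]]
  unfolding total_dist_def[of n "relabel n (rho_perm n) V"] vdist_rho1[OF assms] .

lemma total_dist_sigma: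
  assumes "n > 0" shows "total_dist n (relabel n (sigma_perm n) V) = total_dist n V"
  using total_dist_reindex[where q = "\<lambda>z. 2 - z" and V = V, OF assms bij_res_diff[OF assms]]
  unfolding total_dist_def[of n "relabel n (sigma_perm n) V"] vdist_sigma[OF assms] .

lemma total_dist_eq_0:
  assumes n: "n > 0" and "total_dist n V = 0" shows "vdist n V z w = 0"
proof -
  have nonneg: "vdist n V x y \<ge> 0" for x y by (simp add: vdist_def)
  have "(\<Sum>j\<in>{1..n}. vdist n V (int (res n z)) (int j)) = 0"
    by (rule sum_nonneg_0[OF _ _ assms(2)[unfolded total_dist_def] res_in[OF n]])
       (simp_all add: sum_nonneg nonneg)
  from sum_nonneg_0[OF _ _ this res_in[OF n]] show ?thesis
    by (simp add: nonneg vdist_res[OF n])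
qed

lemma shape_eq:
  assumes "shape n V = shape n W" "total_dist n V = total_dist n W" "total_dist n V \<noteq> 0"
  shows "vdist n V z w = vdist n W z w"
proof -
  have "(\<lambda>(z, w). vdist n V z w / total_dist n V) (z, w) = (\<lambda>(z, w). vdist n W z w / total_dist n W) (z, w)"
    using assms(1) unfolding shape_def code_fun_eq_iff by (rule fun_cong)
  then show ?thesis using assms(2,3) by simp
qed

lemma center_function_size_shape:
  assumes n: "n > 0" shows "center_function n (size_shape n)"
  unfolding center_function_def
proof (intro conjI ballI exI[of _ 1] allI impI)
  fix V assume V: "V \<in> ngons n"
  show "size_shape n (relabel n (sigma_perm n) V) = size_shape n V"
    by (auto simp: size_shape_def relabel_sigma_sigma[OF n V] total_dist_sigma[OF n] fun_eq_iff
        min.commute max.commute)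
  show "size_shape n (apply_ngon n (\<lambda>x. t *\<^sub>R x) V) = t ^ 1 * size_shape n V" if "t \<ge> 0" for t
  proof -
    let ?W = "apply_ngon n (\<lambda>x. t *\<^sub>R x) V"
    have total: "total_dist n ?W = t * total_dist n V"
      by (simp add: total_dist_def vdist_scale[OF n that] sum_distrib_left)
    show ?thesis
    proof (cases "t = 0")
      case True
      \<comment> \<open>Scaling by 0 may change the code, but the size factor vanishes.\<close>
      show ?thesis unfolding size_shape_def total using True by simp
    next
      case False
      have "shape n ?W = shape n V"
        using False by (simp add: shape_def total vdist_scale[OF n that])
      moreover have "shape n (relabel n (sigma_perm n) ?W) = shape n (relabel n (sigma_perm n) V)"
        using False by (simp add: shape_def total total_dist_sigma[OF n] vdist_sigma[OF n] vdist_scale[OF n that])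
      ultimately show ?thesis by (simp add: size_shape_def total)
    qed
  qed
  show "size_shape n (apply_ngon n T V) = size_shape n V" if "rigid_motion T" for T
  proof -
    let ?W = "apply_ngon n T V"
    have total: "total_dist n ?W = total_dist n V"
      by (simp add: total_dist_def vdist_rigid[OF n that])
    have "shape n ?W = shape n V"
      by (simp add: shape_def total vdist_rigid[OF n that])
    moreover have "shape n (relabel n (sigma_perm n) ?W) = shape n (relabel n (sigma_perm n) V)"
      by (simp add: shape_def total total_dist_sigma[OF n] vdist_sigma[OF n] vdist_rigid[OF n that])
    ultimately show ?thesis by (simp add: size_shape_def total)
  qed
qed

text \<open>The shift has the same nonzero size, so the unordered pairs of codes agree. Hence the
  shift has the distances of \<open>W\<close> or of its reflection. The latter is the claim; in the
  former case distances depend only on the label difference up to sign, which also gives it.\<close>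

lemma size_shape_shift:
  assumes n: "n > 0" and nz: "total_dist n W \<noteq> 0"
    and eq: "size_shape n (relabel n (rho_perm n) W) = size_shape n W"
  shows "vdist n W (z + 1) (w + 1) = vdist n W (2 - z) (2 - w)"
proof -
  let ?R = "relabel n (rho_perm n) W" and ?S = "relabel n (sigma_perm n)"
  have "(\<lambda>b. (if b then min else max) (shape n ?R) (shape n (?S ?R)))
      = (\<lambda>b. (if b then min else max) (shape n W) (shape n (?S W)))"
    using eq nz by (simp add: size_shape_def total_dist_rho[OF n])
  from fun_cong[OF this, of True] fun_cong[OF this, of False]
  have "shape n ?R = shape n W \<or> shape n ?R = shape n (?S W)"
    by (auto simp: min_def max_def split: if_splits)
  then show ?thesis
  proof
    assume "shape n ?R = shape n W"
    then have "vdist n ?R z w = vdist n W z w" for z w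
      by (rule shape_eq) (use nz in \<open>simp_all add: total_dist_rho[OF n]\<close>)
    then have step: "vdist n W (z + 1) (w + 1) = vdist n W z w" for z w
      by (simp add: vdist_rho1[OF n])
    have shift: "vdist n W (z + k) (w + k) = vdist n W z w" for z w k
    proof (induction k rule: int_induct[where k = 0])
      case (step1 i)
      then show ?case using step[of "z + i" "w + i"] by (simp add: add_ac)
    next
      case (step2 i)
      then show ?case using step[of "z + (i - 1)" "w + (i - 1)"] by simp
    qed simp
    \<comment> \<open>A shift by \<open>z + w - 1\<close> takes \<open>2 - z\<close> to
      \<open>w + 1\<close> and \<open>2 - w\<close> to \<open>z + 1\<close>; the swap of the
      arguments is undone by symmetry.\<close>
    have "vdist n W (w + 1) (z + 1) = vdist n W (2 - z) (2 - w)"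
      using shift[of "2 - z" "z + w - 1" "2 - w"] by (simp add: algebra_simps)
    then show ?thesis by (metis vdist_commute)
  next
    assume "shape n ?R = shape n (?S W)"
    then have "vdist n ?R z w = vdist n (?S W) z w"
      by (rule shape_eq) (use nz in \<open>simp_all add: total_dist_rho[OF n] total_dist_sigma[OF n]\<close>)
    then show ?thesis by (simp add: vdist_rho1[OF n] vdist_sigma[OF n])
  qed
qed

text \<open>Comparing the shifts by \<open>k\<close> and \<open>k + 1\<close> gives the reflection
  with constant \<open>3 + 2 * k\<close>. Modulo \<open>n\<close>, these are all the odd
  constants.\<close>

lemma S_ngons_if_cyclically_constant:
  assumes n: "n > 0" and V: "V \<in> ngons n" and const: "cyclically_constant n (size_shape n) V"
  shows "V \<in> S_ngons n"
proof (rule S_ngonsI[OF n V])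
  fix K z w :: int
  show "vdist n V (2 * K + 1 - z) (2 * K + 1 - w) = vdist n V z w"
  proof (cases "total_dist n V = 0")
    case True
    then show ?thesis using total_dist_eq_0[OF n] by simp
  next
    case False
    \<comment> \<open>Since \<open>2 * K + 1 = 3 + 2 * (K - 1)\<close>, shifting by
      \<open>K - 1\<close> modulo \<open>n\<close> reduces the constant to 3.\<close>
    define k where "k = nat ((K - 1) mod int n)"
    have k: "int k = (K - 1) mod int n" "k < n" using n by (simp_all add: k_def nat_less_iff)
    obtain q where q: "K - 1 = int k + int n * q"
      using k(1) by (metis add.commute mult_div_mod_eq)
    define W where "W = relabel n (rho_perm n ^^ k) V"
    have "total_dist n (relabel n (rho_perm n ^^ j) V) = total_dist n V" for j
      by (induction j)
        (simp_all only: relabel_rho_0[OF V n] total_dist_rho[OF n] relabel_rho_Suc[OF n, symmetric])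
    then have "total_dist n W \<noteq> 0" using False by (simp add: W_def)
    moreover have "size_shape n (relabel n (rho_perm n) W) = size_shape n W"
    proof -
      have "size_shape n (relabel n (rho_perm n ^^ j) V) = size_shape n V" if "j \<le> n" for j
        \<comment> \<open>For \<open>k = n - 1\<close> the next shift is by \<open>n\<close>,
          outside the range of \<open>cyclically_constant\<close>; it is the identity.\<close>
        using const that relabel_rho_n[OF V n] by (cases "j = n") (auto simp: cyclically_constant_def)
      then show ?thesis using k(2) unfolding W_def relabel_rho_Suc[OF n] by (metis Suc_leI less_imp_le)
    qed
    ultimately have "vdist n W (z - 1 - int k + 1) (w - 1 - int k + 1)
        = vdist n W (2 - (z - 1 - int k)) (2 - (w - 1 - int k))"
      by (rule size_shape_shift[OF n])
    then have "vdist n V z w = vdist n V (3 + 2 * int k - z) (3 + 2 * int k - w)"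
      by (simp add: W_def vdist_rho[OF n] algebra_simps)
    also have "\<dots> = vdist n V (2 * K + 1 - z) (2 * K + 1 - w)"
    proof (rule vdist_cong)
      have *: "2 * K + 1 - x = 3 + 2 * int k - x + int n * (2 * q)" for x
        using q by (simp add: algebra_simps)
      show "(3 + 2 * int k - z) mod int n = (2 * K + 1 - z) mod int n"
        "(3 + 2 * int k - w) mod int n = (2 * K + 1 - w) mod int n"
        unfolding * mod_mult_self2 by simp_all
    qed
    finally show ?thesis by simp
  qed
qed

theorem theorem20:
  "(\<forall>n::nat. odd n \<and> n \<ge> 3 \<longrightarrow>
      (\<exists>f. center_function n f \<and> characterizes n {f} (equilateral_ngons n)))
   \<and>
   (\<forall>n::nat. even n \<and> n \<ge> 4 \<longrightarrow>
      \<not> (\<exists>F. finite F \<and> (\<forall>f\<in>F. center_function n f) \<and>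
            characterizes n F (equilateral_ngons n)) \<and>
      (\<forall>f. center_function n f \<longrightarrow> (\<forall>V\<in>S_ngons n. cyclically_constant n f V)) \<and>
      (\<exists>f. center_function n f \<and> characterizes n {f} (S_ngons n)))"
proof (rule conjI; intro allI impI)
  fix n :: nat assume n: "odd n \<and> n \<ge> 3"
  then obtain m where m: "n = 2 * m + 1" "m \<ge> 1" by (auto elim: oddE)
  have "characterizes n {\<lambda>V. vdist n V (int m + 1) (int m + 2)} (equilateral_ngons n)"
    using cyclically_constant_side_iff[of n _ "int m + 1"] n by (simp add: characterizes_def add_ac)
  with center_function_opposite_side[OF m]
  show "\<exists>f. center_function n f \<and> characterizes n {f} (equilateral_ngons n)" by blast
next
  fix n :: nat assume n: "even n \<and> n \<ge> 4"
  then obtain m where m: "n = 2 * m" "m \<ge> 2" by (auto elim: evenE)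
  have "n > 0" using n by simp
  note const = S_ngons_cyclically_constant[OF this]
  have "doubled_polygon m \<in> S_ngons n" "doubled_polygon m \<notin> equilateral_ngons n"
    using m doubled_polygon_in_S_ngons[of m] doubled_polygon_not_equilateral[of m] by simp_all
  moreover from this have "doubled_polygon m \<in> ngons n" by (simp add: S_ngons_def)
  \<comment> \<open>A family characterized by center functions must contain every member of
    \<open>S_ngons n\<close>, hence also the doubled polygon.\<close>
  ultimately have "\<not> (\<exists>F. finite F \<and> (\<forall>f\<in>F. center_function n f) \<and>
      characterizes n F (equilateral_ngons n))"
    using const unfolding characterizes_def by metis
  moreover have "characterizes n {size_shape n} (S_ngons n)"
    using const[OF center_function_size_shape[OF \<open>n > 0\<close>]] S_ngons_if_cyclically_constant[OF \<open>n > 0\<close>]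
    unfolding characterizes_def by blast
  ultimately show "\<not> (\<exists>F. finite F \<and> (\<forall>f\<in>F. center_function n f) \<and>
        characterizes n F (equilateral_ngons n)) \<and>
      (\<forall>f. center_function n f \<longrightarrow> (\<forall>V\<in>S_ngons n. cyclically_constant n f V)) \<and>
      (\<exists>f. center_function n f \<and> characterizes n {f} (S_ngons n))"
    using const center_function_size_shape[OF \<open>n > 0\<close>] by blast
qed

end
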